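(* Let $G$ be a finite connected simple graph on $n$ vertices which either has diameter $2$, or is bipartite and has diameter $3$. Then $c(G)\leq \sqrt{2n}$.
   Context: Game of Cops and Robbers on a graph $G$: there are $k\geq 1$ cops and one robber. First the cops choose vertices to occupy (several cops may share a vertex), then the robber chooses a vertex. Afterwards cops and robber move in alternate rounds, cops first; in a round each cop (resp. the robber) may move along an edge of $G$ or stay put. The cops win if at some time a cop is on the same vertex as the robber; otherwise the robber wins. The cop number $c(G)$ is the minimum $k$ such that $k$ cops have a strategy that wins against every strategy of the robber. *)

theory Defs
  imports "Graph_Theory.Digraph_Component" "Graph_Theory.Shortest_Path"
begin

text \<open>A finite simple graph is a digraph satisfying \<^locale>\<open>graph\<close>: finite, symmetric, without loops
  and parallel arcs.  With unit arc costs, \<open>\<mu>\<close> is the usual graph distance.\<close>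

definition graph_diameter :: "('a, 'b) pre_digraph \<Rightarrow> ereal" where
  "graph_diameter G = (SUP u\<in>verts G. SUP v\<in>verts G. wf_digraph.\<mu> G (\<lambda>_. 1) u v)"

definition bipartite :: "('a, 'b) pre_digraph \<Rightarrow> bool" where
  "bipartite G \<longleftrightarrow> (\<exists>A B. A \<union> B = verts G \<and> A \<inter> B = {} \<and>
     (\<forall>u v. u \<rightarrow>\<^bsub>G\<^esub> v \<longrightarrow> (u \<in> A \<and> v \<in> B) \<or> (u \<in> B \<and> v \<in> A)))"

text \<open>The cops' positions are a list whose \<open>i\<close>-th entry is the vertex of cop \<open>i\<close>.  A history lists
  the joint positions (cops, robber) at the end of each round so far; its first entry records the
  initial placement.  The strategies of both sides may depend on the whole history, and the robber's
  also on the cops' move (or placement) just made.\<close>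

type_synonym 'a history = "('a list \<times> 'a) list"
type_synonym 'a cop_strategy = "'a history \<Rightarrow> 'a list"
type_synonym 'a robber_strategy = "'a history \<Rightarrow> 'a list \<Rightarrow> 'a"

definition cops_may_move :: "('a, 'b) pre_digraph \<Rightarrow> nat \<Rightarrow> 'a history \<Rightarrow> 'a list \<Rightarrow> bool" where
  "cops_may_move G k h c \<longleftrightarrow> length c = k \<and> set c \<subseteq> verts G \<and>
     (h \<noteq> [] \<longrightarrow> (\<forall>i<k. c ! i = fst (last h) ! i \<or> fst (last h) ! i \<rightarrow>\<^bsub>G\<^esub> c ! i))"

definition robber_may_move :: "('a, 'b) pre_digraph \<Rightarrow> 'a history \<Rightarrow> 'a \<Rightarrow> bool" where
  "robber_may_move G h r \<longleftrightarrow> r \<in> verts G \<and>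
     (h \<noteq> [] \<longrightarrow> r = snd (last h) \<or> snd (last h) \<rightarrow>\<^bsub>G\<^esub> r)"

inductive legal_history :: "('a, 'b) pre_digraph \<Rightarrow> nat \<Rightarrow> 'a history \<Rightarrow> bool"
  for G :: "('a, 'b) pre_digraph" and k :: nat where
  "legal_history G k []"
| "legal_history G k h \<Longrightarrow> cops_may_move G k h c \<Longrightarrow> robber_may_move G h r
    \<Longrightarrow> legal_history G k (h @ [(c, r)])"

definition legal_cop_strategy :: "('a, 'b) pre_digraph \<Rightarrow> nat \<Rightarrow> 'a cop_strategy \<Rightarrow> bool" where
  "legal_cop_strategy G k \<sigma> \<longleftrightarrow> (\<forall>h. legal_history G k h \<longrightarrow> cops_may_move G k h (\<sigma> h))"

definition legal_robber_strategy :: "('a, 'b) pre_digraph \<Rightarrow> nat \<Rightarrow> 'a robber_strategy \<Rightarrow> bool" where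
  "legal_robber_strategy G k \<rho> \<longleftrightarrow>
     (\<forall>h c. legal_history G k h \<longrightarrow> cops_may_move G k h c \<longrightarrow> robber_may_move G h (\<rho> h c))"

primrec play :: "'a cop_strategy \<Rightarrow> 'a robber_strategy \<Rightarrow> nat \<Rightarrow> 'a history" where
  "play \<sigma> \<rho> 0 = []"
| "play \<sigma> \<rho> (Suc t) =
    (let h = play \<sigma> \<rho> t; c = \<sigma> h in h @ [(c, \<rho> h c)])"

text \<open>Capture is tested twice per round: after the cops' move, against the robber's old position
  (if there is one yet), and after the robber's move.\<close>

definition cops_catch :: "'a cop_strategy \<Rightarrow> 'a robber_strategy \<Rightarrow> bool" where
  "cops_catch \<sigma> \<rho> \<longleftrightarrow> (\<exists>t. let h = play \<sigma> \<rho> t; c = \<sigma> h in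
     (h \<noteq> [] \<and> snd (last h) \<in> set c) \<or> \<rho> h c \<in> set c)"

definition cops_win :: "('a, 'b) pre_digraph \<Rightarrow> nat \<Rightarrow> bool" where
  "cops_win G k \<longleftrightarrow> (\<exists>\<sigma>. legal_cop_strategy G k \<sigma> \<and>
     (\<forall>\<rho>. legal_robber_strategy G k \<rho> \<longrightarrow> cops_catch \<sigma> \<rho>))"

definition cop_number :: "('a, 'b) pre_digraph \<Rightarrow> nat" where
  "cop_number G = (LEAST k. k \<ge> 1 \<and> cops_win G k)"

text \<open>The minimum exists for every finite nonempty vertex set: a cop on each vertex wins.\<close>

lemma cops_win_card_verts:
  assumes "finite (verts G)"
  shows "cops_win G (card (verts G))"
proof -
  obtain c where c: "set c = verts G" "distinct c"
    using finite_distinct_list[OF assms] by blast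
  then have len: "length c = card (verts G)"
    using distinct_card by fastforce
  define \<sigma> :: "'a cop_strategy" where "\<sigma> h = (if h = [] then c else fst (last h))" for h
  have "cops_may_move G (card (verts G)) h (\<sigma> h)" if "legal_history G (card (verts G)) h" for h
    using that by cases (auto simp: \<sigma>_def cops_may_move_def c len)
  moreover have "cops_catch \<sigma> \<rho>" if "legal_robber_strategy G (card (verts G)) \<rho>" for \<rho>
  proof -
    have "cops_may_move G (card (verts G)) [] c"
      by (simp add: cops_may_move_def c len)
    with that have "\<rho> [] c \<in> verts G"
      by (auto simp: legal_robber_strategy_def robber_may_move_def intro: legal_history.intros)
    then show ?thesis
      unfolding cops_catch_def by (intro exI[of _ 0]) (simp add: \<sigma>_def c)
  qed
  ultimately show ?thesis
    unfolding cops_win_def legal_cop_strategy_def by blast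
qed

lemma cops_win_cop_number:
  assumes "finite (verts G)" "verts G \<noteq> {}"
  shows "cop_number G \<ge> 1" "cops_win G (cop_number G)"
proof -
  have "card (verts G) \<ge> 1 \<and> cops_win G (card (verts G))"
    using assms by (simp add: cops_win_card_verts Suc_le_eq card_gt_0_iff)
  from LeastI[of "\<lambda>k. k \<ge> 1 \<and> cops_win G k", OF this]
  show "cop_number G \<ge> 1" "cops_win G (cop_number G)"
    unfolding cop_number_def by blast+
qed

end

theory Submission
  imports Defs
begin

text \<open>Station \<open>k\<close> cops on \<open>n\<close> vertices greedily: while \<open>f\<close> cops are free
  and some vertex has more than \<open>f\<close> unguarded vertices in its closed neighbourhood, put one of
  them there for good.  If this used up all cops and left an unguarded vertex, there would be at least
  \<open>(k + 1) + k + \<dots> + 2 + 1\<close> vertices.  So if \<open>2n < (k + 1)(k + 2)\<close>, the greedy process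
  stops with \<open>f\<close> free cops and at most \<open>f\<close> unguarded vertices in each closed neighbourhood of
  an unguarded vertex.  In diameter \<open>2\<close>, the free cops can then in one move guard all places
  the robber can go to.  In a bipartite graph of diameter \<open>3\<close> the free cops start in the same
  class \<open>B\<close>, where distances are at most \<open>2\<close>.  One of them forces the robber into the other
  class, whereupon the others guard its neighbours in \<open>B\<close> and the first one walks up to it.\<close>

text \<open>One move of one player, passing included. Hence \<open>closed_adj G ^^ n\<close> relates
  vertices at distance at most \<open>n\<close>, and \<open>closed_adj G u v\<close> also says that
  a cop on \<open>u\<close> guards \<open>v\<close>.\<close>

definition closed_adj :: "('a, 'b) pre_digraph \<Rightarrow> 'a \<Rightarrow> 'a \<Rightarrow> bool" where
  "closed_adj G u v \<longleftrightarrow> u = v \<or> u \<rightarrow>\<^bsub>G\<^esub> v"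

lemma closed_adj_refl [simp]: "closed_adj G u u"
  by (simp add: closed_adj_def)

lemma list_all2_closed_adj_refl [simp]: "list_all2 (closed_adj G) c c"
  by (simp add: list.rel_refl)

lemma (in wf_digraph) closed_adj_in_verts:
  "closed_adj G u v \<Longrightarrow> u \<in> verts G \<Longrightarrow> v \<in> verts G"
  by (auto simp: closed_adj_def)

lemma (in wf_digraph) list_all2_closed_adj_in_verts:
  assumes "list_all2 (closed_adj G) c c'" "set c \<subseteq> verts G"
  shows "set c' \<subseteq> verts G"
  using assms by (induction rule: list_all2_induct) (auto intro: closed_adj_in_verts)

section \<open>Winning positions\<close>

text \<open>With the cops to move, they can catch the robber within \<open>n\<close> rounds.\<close>

fun cops_force :: "('a, 'b) pre_digraph \<Rightarrow> nat \<Rightarrow> 'a list \<Rightarrow> 'a \<Rightarrow> bool" where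
  "cops_force G 0 c r \<longleftrightarrow> False"
| "cops_force G (Suc n) c r \<longleftrightarrow> (\<exists>c'. list_all2 (closed_adj G) c c' \<and>
     (r \<in> set c' \<or> (\<forall>r'. closed_adj G r r' \<longrightarrow> r' \<in> set c' \<or> cops_force G n c' r')))"

declare cops_force.simps [simp del]

lemma cops_force_0 [simp]: "\<not> cops_force G 0 c r"
  by (simp add: cops_force.simps)

lemma cops_force_SucI:
  assumes "list_all2 (closed_adj G) c c'"
    and "\<And>r'. closed_adj G r r' \<Longrightarrow> cops_force G n c' r'"
  shows "cops_force G (Suc n) c r"
  unfolding cops_force.simps(2) using assms by (intro exI[of _ c']) simp

lemma cops_force_Suc_mono: "cops_force G n c r \<Longrightarrow> cops_force G (Suc n) c r"
proof (induction n arbitrary: c r)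
  case (Suc n)
  from Suc.prems obtain c' where "list_all2 (closed_adj G) c c'"
    "r \<in> set c' \<or> (\<forall>r'. closed_adj G r r' \<longrightarrow> r' \<in> set c' \<or> cops_force G n c' r')"
    unfolding cops_force.simps(2) by blast
  then show ?case
    using Suc.IH unfolding cops_force.simps(2)[of _ "Suc n"] by blast
qed simp

lemma cops_force_adjacent:
  assumes "x \<in> set c" "closed_adj G x r"
  shows "cops_force G (Suc n) c r"
proof -
  obtain i where i: "i < length c" "c ! i = x"
    using assms(1) by (auto simp: in_set_conv_nth)
  have "list_all2 (closed_adj G) c (c[i := r])"
    using i assms(2) by (auto simp: list_all2_conv_all_nth nth_list_update)
  moreover have "r \<in> set (c[i := r])"
    using i by (simp add: set_update_memI)
  ultimately show ?thesis unfolding cops_force.simps(2) by blast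
qed

text \<open>The strategy picks a forcing move by choice and reads the number of remaining rounds off
  the length of the history. A robber that is never caught would reach a position with
  \<open>cops_force G 0\<close>, which is impossible.\<close>

lemma (in wf_digraph) cops_win_if_force:
  assumes c0: "set c0 \<subseteq> verts G" and force: "\<And>r. r \<in> verts G \<Longrightarrow> cops_force G N c0 r"
  shows "cops_win G (length c0)"
proof -
  define good where "good n c r c' \<longleftrightarrow> list_all2 (closed_adj G) c c' \<and>
     (r \<in> set c' \<or> (\<forall>r'. closed_adj G r r' \<longrightarrow> r' \<in> set c' \<or> cops_force G n c' r'))" for n c r c'
  \<comment> \<open>Passing is the default, since a legal strategy must also answer the legal
    histories in which no good move exists.\<close>
  define mv where "mv n c r = (if \<exists>c'. good n c r c' then SOME c'. good n c r c' else c)" for n c r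
  \<comment> \<open>The placement is itself a history entry: at length \<open>Suc t\<close> there
    are \<open>N - t\<close> rounds left before the cops' move and \<open>N - Suc t\<close> after
    it, the index that \<open>good\<close> uses.\<close>
  define \<sigma> where "\<sigma> h = (if h = [] then c0 else mv (N - length h) (fst (last h)) (snd (last h)))"
    for h :: "'a history"
  have \<sigma>_eq: "\<sigma> h = mv (N - length h) (fst (last h)) (snd (last h))" if "h \<noteq> []" for h
    using that by (simp add: \<sigma>_def)
  have mv_good: "good n c r (mv n c r)" if "cops_force G (Suc n) c r" for n c r
    proof -
    have "\<exists>c'. good n c r c'"
      using that unfolding good_def cops_force.simps(2) by blast
    then show ?thesis unfolding mv_def by (simp add: someI_ex)
  qed
  have mv_step: "list_all2 (closed_adj G) c (mv n c r)" for n c r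
  proof (cases "\<exists>c'. good n c r c'")
    case True
    then have "good n c r (mv n c r)"
      unfolding mv_def by (simp add: someI_ex)
    then show ?thesis by (simp add: good_def)
  qed (simp add: mv_def)
  have legal: "cops_may_move G (length c0) h (\<sigma> h)" if h: "legal_history G (length c0) h" for h
  proof (cases "h = []")
    case True
    then show ?thesis by (simp add: \<sigma>_def cops_may_move_def c0)
  next
    case False
    from h have last: "length (fst (last h)) = length c0" "set (fst (last h)) \<subseteq> verts G"
      by (cases; use False in \<open>simp add: cops_may_move_def\<close>)+
    have step: "list_all2 (closed_adj G) (fst (last h)) (\<sigma> h)"
      using mv_step \<sigma>_eq[OF False] by simp
    show ?thesis
      using last list_all2_closed_adj_in_verts[OF step] list_all2_lengthD[OF step]
        list_all2_nthD[OF step] by (simp add: cops_may_move_def closed_adj_def) metis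
  qed
  have "cops_catch \<sigma> \<rho>" if \<rho>: "legal_robber_strategy G (length c0) \<rho>" for \<rho>
  proof (rule ccontr)
    assume "\<not> cops_catch \<sigma> \<rho>"
    then have free: "play \<sigma> \<rho> t \<noteq> [] \<Longrightarrow> snd (last (play \<sigma> \<rho> t)) \<notin> set (\<sigma> (play \<sigma> \<rho> t))"
      "\<rho> (play \<sigma> \<rho> t) (\<sigma> (play \<sigma> \<rho> t)) \<notin> set (\<sigma> (play \<sigma> \<rho> t))" for t
      by (auto simp: cops_catch_def Let_def)
    have hist: "legal_history G (length c0) (play \<sigma> \<rho> t)" for t
    proof (induction t)
      case (Suc t)
      then show ?case
        using legal[OF Suc] \<rho> unfolding legal_robber_strategy_def
        by (auto simp: Let_def intro!: legal_history.intros)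
    qed (simp add: legal_history.intros)
    have len: "length (play \<sigma> \<rho> t) = t" for t
      by (induction t) (auto simp: Let_def)
    have move: "robber_may_move G (play \<sigma> \<rho> t) (\<rho> (play \<sigma> \<rho> t) (\<sigma> (play \<sigma> \<rho> t)))" for t
      using \<rho> hist legal unfolding legal_robber_strategy_def by blast
    have inv: "cops_force G (N - t) (fst (last (play \<sigma> \<rho> (Suc t)))) (snd (last (play \<sigma> \<rho> (Suc t))))"
      if "t \<le> N" for t
      using that
    proof (induction t)
      case 0
      then show ?case
        using force move[of 0] by (simp add: \<sigma>_def Let_def robber_may_move_def)
    next
      case (Suc t)
      let ?h = "play \<sigma> \<rho> (Suc t)"
      have ne: "?h \<noteq> []" by (simp add: Let_def)
      have N: "N - t = Suc (N - Suc t)" using Suc.prems by simp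
      have "\<sigma> ?h = mv (N - Suc t) (fst (last ?h)) (snd (last ?h))"
        using \<sigma>_eq[OF ne] unfolding len .
      moreover have "cops_force G (Suc (N - Suc t)) (fst (last ?h)) (snd (last ?h))"
        using Suc.IH Suc.prems unfolding N by (simp del: play.simps)
      ultimately have good: "good (N - Suc t) (fst (last ?h)) (snd (last ?h)) (\<sigma> ?h)"
        using mv_good by metis
      have "closed_adj G (snd (last ?h)) (\<rho> ?h (\<sigma> ?h))"
        using move[of "Suc t"] ne
        by (auto simp: robber_may_move_def closed_adj_def simp del: play.simps)
      then have "cops_force G (N - Suc t) (\<sigma> ?h) (\<rho> ?h (\<sigma> ?h))"
        using good free[of "Suc t"] ne by (auto simp: good_def simp del: play.simps)
      then show ?case by (simp add: play.simps(2)[of _ _ "Suc t"] Let_def del: play.simps)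
    qed
    show False using inv[of N] by simp
  qed
  then show ?thesis
    using legal unfolding cops_win_def legal_cop_strategy_def by blast
qed

section \<open>Stationed cops, guards and the chaser\<close>

text \<open>Induction on the number \<open>k\<close> of cops still free, with \<open>H\<close> the
  vertices still unguarded. The bound is twice the triangular number
  \<open>1 + 2 + ... + (k + 1)\<close>.\<close>

lemma (in wf_digraph) station_cops:
  assumes "finite H" "H \<subseteq> verts G" "2 * card H < (k + 1) * (k + 2)"
  shows "\<exists>S U. length S \<le> k \<and> set S \<subseteq> verts G \<and> U \<subseteq> H \<and>
    (\<forall>v\<in>H - U. \<exists>s\<in>set S. closed_adj G s v) \<and>
    (\<forall>u\<in>U. card {v\<in>U. closed_adj G u v} \<le> k - length S)"
  using assms
proof (induction k arbitrary: H)
  case 0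
  from 0(3) have "card H = 0" by simp
  with 0(1) have "H = {}" by simp
  then show ?case by (intro exI[of _ "[]"] exI[of _ "{}"]) simp
next
  case (Suc k)
  show ?case
  proof (cases "\<forall>u\<in>H. card {v\<in>H. closed_adj G u v} \<le> Suc k")
    case True
    \<comment> \<open>The greedy process stops here: no further cop is stationed and all of
      \<open>H\<close> stays unguarded.\<close>
    then show ?thesis by (intro exI[of _ "[]"] exI[of _ H]) simp
  next
    case False
    then obtain u where u: "u \<in> H" "card {v\<in>H. closed_adj G u v} \<ge> k + 2" by force
    define H' where "H' = {v\<in>H. \<not> closed_adj G u v}"
    have "card H = card {v\<in>H. closed_adj G u v} + card H'"
      unfolding H'_def using Suc.prems(1)
      by (subst card_Un_disjoint[symmetric]) (auto intro: arg_cong[where f = card])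
    \<comment> \<open>A cop on \<open>u\<close> removes at least \<open>k + 2\<close> vertices from
      \<open>H\<close>, and
      \<open>(k + 2) * (k + 3) - 2 * (k + 2) = (k + 1) * (k + 2)\<close>.\<close>
    then have H': "2 * card H' < (k + 1) * (k + 2)"
      using u Suc.prems(3) by (simp add: algebra_simps)
    have "finite H'" "H' \<subseteq> verts G" using Suc.prems by (auto simp: H'_def)
    from Suc.IH[OF this H'] obtain S U
      where SU: "length S \<le> k" "set S \<subseteq> verts G" "U \<subseteq> H'"
      "\<forall>v\<in>H' - U. \<exists>s\<in>set S. closed_adj G s v"
      "\<forall>u\<in>U. card {v\<in>U. closed_adj G u v} \<le> k - length S" by blast
    then show ?thesis
      using u Suc.prems
      by (intro exI[of _ "u # S"] exI[of _ U]) (auto simp: H'_def)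
  qed
qed

text \<open>Each guard takes a target of its own and moves to the middle of a walk to it; guards
  left without a target stay put.\<close>

lemma guards_cover:
  assumes "finite Y" "card Y \<le> length F"
    and "\<And>x y. x \<in> set F \<Longrightarrow> y \<in> Y \<Longrightarrow> (closed_adj G ^^ 2) x y"
  shows "\<exists>F'. list_all2 (closed_adj G) F F' \<and> (\<forall>y\<in>Y. \<exists>x\<in>set F'. closed_adj G x y)"
  using assms
proof (induction F arbitrary: Y)
  case (Cons x F)
  show ?case
  proof (cases "Y = {}")
    case False
    then obtain y where y: "y \<in> Y" by blast
    then obtain z where z: "closed_adj G x z" "closed_adj G z y"
      using Cons.prems(3)[of x y] by (auto simp: numeral_2_eq_2)
    have "card (Y - {y}) \<le> length F"
      using Cons.prems y by simp
    then obtain F' where "list_all2 (closed_adj G) F F'"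
      "\<forall>y\<in>Y - {y}. \<exists>x\<in>set F'. closed_adj G x y"
      using Cons.IH[of "Y - {y}"] Cons.prems by auto
    then show ?thesis
      using z by (intro exI[of _ "z # F'"]) auto
  qed (auto intro: exI[of _ "x # F"])
qed simp

text \<open>A robber that leaves \<open>r\<close> steps next to a cop of \<open>c\<close> and is
  caught. If it stays, the cop on \<open>p\<close> comes one step closer each round.\<close>

lemma cops_force_trapped:
  assumes "\<And>r'. closed_adj G r r' \<Longrightarrow> r' \<noteq> r \<Longrightarrow> \<exists>x\<in>set c. closed_adj G x r'"
    and "(closed_adj G ^^ n) p r"
  shows "cops_force G (Suc n) (p # c) r"
  using assms(2)
proof (induction n arbitrary: p)
  case 0
  then show ?case by (intro cops_force_adjacent[of p]) auto
next
  case (Suc n)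
  from relpowp_Suc_D2[OF Suc.prems] obtain q
    where q: "closed_adj G p q" "(closed_adj G ^^ n) q r" by blast
  have "cops_force G (Suc n) (q # c) r'" if "closed_adj G r r'" for r'
  proof (cases "r' = r")
    case False
    then show ?thesis
      using assms(1)[OF that] by (auto intro: cops_force_adjacent)
  qed (use Suc.IH[OF q(2)] in simp)
  moreover have "list_all2 (closed_adj G) (p # c) (q # c)" using q(1) by simp
  ultimately show ?case by (rule cops_force_SucI[rotated])
qed

section \<open>Distances\<close>

text \<open>Walks shorter than \<open>n\<close> are padded by passing.\<close>

lemma (in wf_digraph) awalk_imp_relpowp:
  assumes "awalk u p v" "length p \<le> n"
  shows "(closed_adj G ^^ n) u v"
  using assms
proof (induction n arbitrary: u p)
  case 0
  then show ?case by (simp add: awalk_Nil_iff)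
next
  case (Suc n)
  show ?case
  proof (cases p)
    case Nil
    with Suc show ?thesis
      by (metis awalk_Nil_iff closed_adj_refl relpowp_Suc_I2 zero_le list.size(3))
  next
    case (Cons e es)
    with Suc.prems have "closed_adj G u (head G e)" "awalk (head G e) es v" "length es \<le> n"
      by (auto simp: awalk_Cons_iff closed_adj_def intro: in_arcs_imp_in_arcs_ends)
    with Suc.IH show ?thesis by (blast intro: relpowp_Suc_I2)
  qed
qed

lemma (in wf_digraph) short_awalk:
  assumes "graph_diameter G \<le> ereal (real d)" "u \<in> verts G" "v \<in> verts G"
  obtains p where "awalk u p v" "length p \<le> d"
proof -
  have "\<mu> (\<lambda>_. 1) u v \<le> graph_diameter G"
    unfolding graph_diameter_def using assms(2,3) by (intro SUP_upper2[of u] SUP_upper) auto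
  \<comment> \<open>An infimum yields a witness only below a strict bound. \<open>Suc d\<close>
    serves, because the cost of a walk is its length, an integer.\<close>
  also have "\<dots> < ereal (real (Suc d))"
    using assms(1) by (rule le_less_trans) simp
  finally obtain p where p: "awalk u p v" "ereal (awalk_cost (\<lambda>_. 1) p) < ereal (real (Suc d))"
    by (auto simp: \<mu>_def INF_less_iff)
  have "awalk_cost (\<lambda>_. 1) p = real (length p)"
    by (induction p) auto
  with p that show ?thesis by simp
qed

text \<open>Every arc changes the class. This is what lowers distance 3 to distance 2 inside one
  class.\<close>

lemma (in wf_digraph) bipartite_awalk_parity:
  assumes "awalk u p v" "A \<inter> B = {}" "u \<in> A \<union> B"
    and "\<And>x y. x \<rightarrow> y \<Longrightarrow> x \<in> A \<and> y \<in> B \<or> x \<in> B \<and> y \<in> A"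
  shows "even (length p) \<longleftrightarrow> (u \<in> B \<longleftrightarrow> v \<in> B)"
  using assms(1,3)
proof (induction p arbitrary: u)
  case Nil
  then show ?case by (simp add: awalk_Nil_iff)
next
  case (Cons e es)
  then have "u \<rightarrow> head G e" "awalk (head G e) es v"
    by (auto simp: awalk_Cons_iff intro: in_arcs_imp_in_arcs_ends)
  with Cons.IH[of "head G e"] assms(2) assms(4)[of u "head G e"] show ?case by auto
qed

section \<open>The two strategies\<close>

lemma (in graph) cops_win_diameter_2:
  assumes "graph_diameter G \<le> 2" "verts G \<noteq> {}"
    and "2 * card (verts G) < (k + 1) * (k + 2)"
  shows "cops_win G k"
proof -
  obtain S U where SU: "length S \<le> k" "set S \<subseteq> verts G" "U \<subseteq> verts G"
    "\<forall>v\<in>verts G - U. \<exists>s\<in>set S. closed_adj G s v"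
    "\<forall>u\<in>U. card {v\<in>U. closed_adj G u v} \<le> k - length S"
    using station_cops[of "verts G" k] assms(3) by auto
  obtain v where v: "v \<in> verts G" using assms(2) by blast
  have diam: "(closed_adj G ^^ 2) x y" if "x \<in> verts G" "y \<in> verts G" for x y
    using short_awalk[of 2 x y] assms(1) that awalk_imp_relpowp[of x _ y 2] by auto
  define F where "F = replicate (k - length S) v"
  have "cops_force G 2 (S @ F) r" if r: "r \<in> verts G" for r
  proof (cases "r \<in> U")
    case False
    then obtain s where "s \<in> set S" "closed_adj G s r" using SU(4) r by blast
    then show ?thesis by (simp add: numeral_2_eq_2 cops_force_adjacent[of s])
  next
    case True
    \<comment> \<open>The replies, staying included, that no stationed cop guards. There are enough
      free cops to guard them all in one move, so the second move captures.\<close>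
    let ?Y = "{y\<in>U. closed_adj G r y}"
    have "finite ?Y" using finite_subset[OF SU(3)] by simp
    moreover have "card ?Y \<le> length F" using SU(5) True by (simp add: F_def)
    moreover have "(closed_adj G ^^ 2) x y" if "x \<in> set F" "y \<in> ?Y" for x y
      using that SU(3) v diam by (auto simp: F_def)
    ultimately obtain F' where F': "list_all2 (closed_adj G) F F'"
      "\<forall>y\<in>?Y. \<exists>x\<in>set F'. closed_adj G x y"
      using guards_cover by blast
    have "cops_force G 1 (S @ F') r'" if r': "closed_adj G r r'" for r'
    proof -
      have "\<exists>x\<in>set (S @ F'). closed_adj G x r'"
        using F'(2) SU(4) r r' closed_adj_in_verts[OF r'] by (cases "r' \<in> U") auto
      then show ?thesis using cops_force_adjacent[of _ "S @ F'" G r' 0] by auto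
    qed
    moreover have "list_all2 (closed_adj G) (S @ F) (S @ F')"
      by (simp add: list_all2_appendI F'(1))
    ultimately have "cops_force G (Suc 1) (S @ F) r"
      by (rule cops_force_SucI[rotated])
    then show ?thesis by (simp add: numeral_2_eq_2)
  qed
  then have "cops_win G (length (S @ F))"
    using SU v by (intro cops_win_if_force) (auto simp: F_def)
  then show ?thesis using SU(1) by (simp add: F_def)
qed

lemma (in graph) cops_win_bipartite_diameter_3:
  assumes bip: "bipartite G" and diam: "graph_diameter G \<le> 3" and ne: "verts G \<noteq> {}"
    and card: "2 * card (verts G) < (k + 1) * (k + 2)"
  shows "cops_win G k"
proof -
  obtain S U where SU: "length S \<le> k" "set S \<subseteq> verts G" "U \<subseteq> verts G"
    "\<forall>v\<in>verts G - U. \<exists>s\<in>set S. closed_adj G s v"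
    "\<forall>u\<in>U. card {v\<in>U. closed_adj G u v} \<le> k - length S"
    using station_cops[of "verts G" k] card by auto
  have finU: "finite U" using finite_subset[OF SU(3)] by simp
  \<comment> \<open>The classes are named so that \<open>B\<close> is nonempty; the free cops start
    on \<open>b\<close>.\<close>
  obtain A B b where AB: "A \<union> B = verts G" "A \<inter> B = {}"
    "\<And>x y. x \<rightarrow> y \<Longrightarrow> x \<in> A \<and> y \<in> B \<or> x \<in> B \<and> y \<in> A" and b: "b \<in> B"
  proof -
    obtain A B where AB: "A \<union> B = verts G" "A \<inter> B = {}"
      "\<And>x y. x \<rightarrow> y \<Longrightarrow> x \<in> A \<and> y \<in> B \<or> x \<in> B \<and> y \<in> A"
      using bip unfolding bipartite_def by blast
    obtain v where "v \<in> A \<or> v \<in> B" using ne AB(1) by blast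
    then show ?thesis
    proof
      assume "v \<in> A"
      show ?thesis
        by (rule that[of B A v]) (use AB \<open>v \<in> A\<close> in blast)+
    next
      assume "v \<in> B"
      show ?thesis
        by (rule that[of A B v]) (use AB \<open>v \<in> B\<close> in blast)+
    qed
  qed
  have walk: "\<exists>p. awalk x p y \<and> length p \<le> 3" if "x \<in> verts G" "y \<in> verts G" for x y
    using short_awalk[of 3 x y] diam that by auto
  have dist3: "(closed_adj G ^^ 3) x y" if "x \<in> verts G" "y \<in> verts G" for x y
    using walk[OF that] awalk_imp_relpowp by blast
  have dist2: "(closed_adj G ^^ 2) x y" if xy: "x \<in> B" "y \<in> B" for x y
  proof -
    obtain p where p: "awalk x p y" "length p \<le> 3"
      using walk xy AB(1) by blast
    have "even (length p)"
      using bipartite_awalk_parity[OF p(1) AB(2) _ AB(3)] xy by blast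
    with p(2) have "length p \<le> 2"
      by (cases "length p = 3") auto
    with p(1) show ?thesis by (rule awalk_imp_relpowp)
  qed
  show ?thesis
  \<comment> \<open>With no free cop there is no chaser, but then every vertex is guarded: an
    unguarded \<open>u\<close> would count itself among at most 0 vertices.\<close>
  proof (cases "length S = k")
    case True
    have "U = {}"
    proof (rule ccontr)
      assume "U \<noteq> {}"
      then obtain u where u: "u \<in> U" by blast
      then have "card {v\<in>U. closed_adj G u v} = 0" using SU(5) True by auto
      with u finU show False by auto
    qed
    then have "cops_force G (Suc 0) S r" if "r \<in> verts G" for r
      using SU(4) that cops_force_adjacent by (metis Diff_empty)
    then show ?thesis using cops_win_if_force SU(2) True by blast
  next
    case False
    define F where "F = replicate (k - length S - 1) b"
    have lenF: "length F = k - length S - 1" "set F \<subseteq> B"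
      using b by (auto simp: F_def)
    \<comment> \<open>One round for the guards to take position, then four for the chaser at
      distance at most 3. Its place \<open>p\<close> is arbitrary, as it may have moved
      before.\<close>
    have forceA: "cops_force G 5 (p # S @ F) r"
      if p: "p \<in> verts G" and r: "r \<in> U" "r \<in> A" for p r
    proof -
      \<comment> \<open>The vertex \<open>r\<close> is left to the chaser. This saves one guard,
        which makes up for the free cop used as chaser.\<close>
      let ?Y = "{y\<in>U. closed_adj G r y} - {r}"
      have "card ?Y = card {y\<in>U. closed_adj G r y} - 1"
        using r finU by (subst card_Diff_singleton) auto
      then have "card ?Y \<le> length F" using SU(5) r(1) lenF False by fastforce
      moreover have "finite ?Y" using finU by simp
      moreover have "(closed_adj G ^^ 2) x y" if "x \<in> set F" "y \<in> ?Y" for x y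
      proof -
        have "r \<rightarrow> y" using that by (auto simp: closed_adj_def)
        then have "y \<in> B" using AB(2) AB(3)[of r y] r by blast
        then show ?thesis using dist2 that lenF by blast
      qed
      ultimately obtain F' where F': "list_all2 (closed_adj G) F F'"
        "\<forall>y\<in>?Y. \<exists>x\<in>set F'. closed_adj G x y"
        using guards_cover by blast
      have rV: "r \<in> verts G" using r SU(3) by blast
      have guarded: "\<exists>x\<in>set (S @ F'). closed_adj G x r'" if "closed_adj G r r'" "r' \<noteq> r" for r'
        using F'(2) SU(4) that closed_adj_in_verts[OF that(1) rV] by (cases "r' \<in> U") auto
      have "cops_force G 4 (p # S @ F') r'" if "closed_adj G r r'" for r'
      proof (cases "r' = r")
        case True
        have "(closed_adj G ^^ 3) p r" using dist3 p r SU(3) by blast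
        then have "cops_force G (Suc 3) (p # S @ F') r"
          using guarded by (rule cops_force_trapped[rotated])
        then show ?thesis using True by (simp)
      next
        case False
        obtain x where "x \<in> set (p # S @ F')" "closed_adj G x r'"
          using guarded[of r'] \<open>closed_adj G r r'\<close> False by auto
        from cops_force_adjacent[OF this, of 3] show ?thesis by (simp)
      qed
      moreover have "list_all2 (closed_adj G) (p # S @ F) (p # S @ F')"
        by (simp add: list_all2_appendI F'(1))
      ultimately have "cops_force G (Suc 4) (p # S @ F) r"
        by (rule cops_force_SucI[rotated])
      then show ?thesis by (simp)
    qed
    have "cops_force G 6 (b # S @ F) r" if r: "r \<in> verts G" for r
    proof (cases "r \<in> A \<and> r \<in> U")
      case True
      then have "cops_force G 5 (b # S @ F) r" using forceA b AB(1) by blast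
      then have "cops_force G (Suc 5) (b # S @ F) r" by (rule cops_force_Suc_mono)
      then show ?thesis by simp
    next
      case not_AU: False
      show ?thesis
      proof (cases "r \<in> U")
        case False
        then obtain s where "s \<in> set S" "closed_adj G s r" using SU(4) r by blast
        then have "cops_force G (Suc 5) (b # S @ F) r" by (intro cops_force_adjacent[of s]) auto
        then show ?thesis by (simp)
      next
        case True
        then have rB: "r \<in> B" using not_AU AB(1) r by blast
        then obtain z where z: "closed_adj G b z" "closed_adj G z r"
          using dist2[OF b] by (auto simp: numeral_2_eq_2)
        have zV: "z \<in> verts G" using z closed_adj_in_verts b AB(1) by blast
        \<comment> \<open>The chaser on \<open>z\<close> now threatens \<open>r\<close>, so the
          robber must leave \<open>B\<close> for an unguarded vertex of \<open>A\<close>, while the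
          guards have not moved from \<open>b\<close>.\<close>
        have "cops_force G 5 (z # S @ F) r'" if r': "closed_adj G r r'" for r'
        proof (cases "r' = r \<or> r' \<notin> U")
          case True
          then obtain x where "x \<in> set (z # S @ F)" "closed_adj G x r'"
            using z SU(4) closed_adj_in_verts[OF r' r] by auto
          then have "cops_force G (Suc 4) (z # S @ F) r'"
            by (rule cops_force_adjacent)
          then show ?thesis by (simp)
        next
          case False
          then have "r \<rightarrow> r'" using r' by (auto simp: closed_adj_def)
          then have "r' \<in> A" using AB(2) AB(3)[of r r'] rB by blast
          then show ?thesis using forceA zV False by blast
        qed
        moreover have "list_all2 (closed_adj G) (b # S @ F) (z # S @ F)"
          using z by simp
        ultimately have "cops_force G (Suc 5) (b # S @ F) r"
          by (rule cops_force_SucI[rotated])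
        then show ?thesis by (simp)
      qed
    qed
    then have "cops_win G (length (b # S @ F))"
      using SU b AB(1) lenF by (intro cops_win_if_force) auto
    then show ?thesis using SU(1) False lenF by simp
  qed
qed

theorem theorem1:
  fixes G :: "('a, 'b) pre_digraph"
  assumes "graph G"
    and "Digraph_Component.connected G"
    and "graph_diameter G = 2 \<or> (bipartite G \<and> graph_diameter G = 3)"
  shows "real (cop_number G) \<le> sqrt (2 * real (card (verts G)))"
proof -
  interpret graph G by fact
  let ?c = "cop_number G" and ?n = "card (verts G)"
  have ne: "verts G \<noteq> {}"
    using assms(2) by (auto simp: connected_def strongly_connected_def)
  have c1: "?c \<ge> 1"
    using cops_win_cop_number(1)[of G] ne by simp
  have "?c ^ 2 \<le> 2 * ?n"
  \<comment> \<open>The case is separate because minimality of the cop number says nothing about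
    \<open>?c - 1 = 0\<close> cops.\<close>
  proof (cases "?c = 1")
    case True
    have "?n > 0" using ne by (simp add: card_gt_0_iff)
    with True show ?thesis by simp
  next
    case False
    then have "\<not> cops_win G (?c - 1)"
      using c1 not_less_Least[of "?c - 1" "\<lambda>k. k \<ge> 1 \<and> cops_win G k"]
      unfolding cop_number_def by linarith
    \<comment> \<open>With \<open>k = ?c - 1\<close> the two strategies would win below this bound;
      its failure gives \<open>?c * (?c + 1) \<le> 2 * ?n\<close>, slightly more than the square
      bound.\<close>
    then have "\<not> 2 * ?n < (?c - 1 + 1) * (?c - 1 + 2)"
      using assms(3) ne cops_win_diameter_2 cops_win_bipartite_diameter_3 by (metis order_refl)
    then have "?c * (?c + 1) \<le> 2 * ?n" using c1 by simp
    then show ?thesis by (simp add: power2_eq_square)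
  qed
  then have "real ?c ^ 2 \<le> 2 * real ?n"
    by (metis of_nat_le_iff of_nat_mult of_nat_numeral of_nat_power)
  then show ?thesis by (rule real_le_rsqrt)
qed

end
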